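(* Consider the problem $\min_x f(x)$ with $f=\sum_{i=1}^n f_i$. If the objective function $f$ is such that its strong convexity parameter $\mu$ equals the Lipschitz constant $L$ of its gradient $\nabla f$, then the iterates generated by the centralized Barzilai--Borwein algorithm (described in the context) converge superlinearly to the optimal solution $x^*$.
   Context: $\|\cdot\|$ is the Euclidean norm. Centralized Barzilai--Borwein algorithm: given $x(0)$ and an initial step size $\alpha(0)$, iterate $x(k+1)=x(k)-\alpha(k)\nabla f(x(k))$, where for $k\ge1$, with $s(k-1)=x(k)-x(k-1)$ and $y(k-1)=\nabla f(x(k))-\nabla f(x(k-1))$, the step size is $$\alpha(k)=\alpha_1(k)=\frac{s(k-1)^Ts(k-1)}{s(k-1)^Ty(k-1)}$$ (the choice $\alpha(k)=\alpha_2(k)=\frac{s(k-1)^Ty(k-1)}{y(k-1)^Ty(k-1)}$ may also be used). If $\nabla f(x(k))=0$ for some $k$, the algorithm stops, and one sets $x(j)=x(k)=x^*$ for $j\ge k$. Standing assumptions: the decision set $\mathcal{X}$, in which the decision variable takes its values, is bounded; $f$ is twice differentiable and strongly convex with parameter $\mu>0$, i.e. $f(x)\ge f(y)+\nabla f(y)^T(x-y)+\frac{\mu}{2}\|x-y\|^2$ for all $x,y$; $s(k-1)^Ty(k-1)>0$ at every step $k\ge1$ at which the step size is computed; $\|\nabla f(x)-\nabla f(y)\|\le L\|x-y\|$ for all $x,y$. $x^*$ is the minimizer of $f$. Superlinear convergence means that there are $r_k\ge0$ with $r_k\to0$ and $\|x(k+1)-x^*\|\le r_k\|x(k)-x^*\|$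 for all sufficiently large $k$. *)

theory Defs
  imports "HOL-Analysis.Analysis"
begin

definition nabla :: "('a::euclidean_space \<Rightarrow> real) \<Rightarrow> 'a \<Rightarrow> 'a" where
  "nabla f x = (THE D. GDERIV f x :> D)"

lemma GDERIV_nabla:
  fixes f :: "'a::euclidean_space \<Rightarrow> real"
  assumes "f differentiable (at x)"
  shows "GDERIV f x :> nabla f x"
proof -
  obtain f' where f': "(f has_derivative f') (at x)"
    using assms by (auto simp: differentiable_def)
  then interpret bounded_linear f'
    by (rule has_derivative_bounded_linear)
  define D where "D = (\<Sum>b\<in>Basis. f' b *\<^sub>R b)"
  have "f' h = h \<bullet> D" for h
  proof -
    have "f' h = f' (\<Sum>b\<in>Basis. (h \<bullet> b) *\<^sub>R b)"
      by (simp add: euclidean_representation)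
    also have "\<dots> = (\<Sum>b\<in>Basis. (h \<bullet> b) * f' b)"
      by (simp add: sum scaleR)
    finally show ?thesis
      by (simp add: D_def inner_sum_right mult.commute)
  qed
  then have "f' = (\<lambda>h. h \<bullet> D)"
    by blast
  with f' have D: "GDERIV f x :> D"
    by (simp add: gderiv_def)
  have "E = D" if "GDERIV f x :> E" for E
  proof -
    have "(\<lambda>h. h \<bullet> E) = (\<lambda>h. h \<bullet> D)"
      using that D unfolding gderiv_def by (rule has_derivative_unique)
    then show ?thesis
      by (metis inner_commute vector_eq_rdot)
  qed
  with D show ?thesis
    unfolding nabla_def by (metis theI)
qed

(* The neighbourhood clause makes nabla f the true gradient around x, so that its
   differentiability at x is meaningful. *)
definition twice_differentiable_at :: "('a::euclidean_space \<Rightarrow> real) \<Rightarrow> 'a \<Rightarrow> bool" where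
  "twice_differentiable_at f x \<longleftrightarrow>
     (\<forall>\<^sub>F y in nhds x. f differentiable (at y)) \<and> nabla f differentiable (at x)"

definition strongly_convex_on :: "'a::euclidean_space set \<Rightarrow> real \<Rightarrow> ('a \<Rightarrow> real) \<Rightarrow> bool" where
  "strongly_convex_on X \<mu> f \<longleftrightarrow> \<mu> > 0 \<and>
     (\<forall>x\<in>X. \<forall>y\<in>X. f x \<ge> f y + nabla f y \<bullet> (x - y) + \<mu> / 2 * (norm (x - y))\<^sup>2)"

definition bb_s :: "(nat \<Rightarrow> 'a::euclidean_space) \<Rightarrow> nat \<Rightarrow> 'a" where
  "bb_s x k = x (Suc k) - x k"

definition bb_y :: "('a::euclidean_space \<Rightarrow> real) \<Rightarrow> (nat \<Rightarrow> 'a) \<Rightarrow> nat \<Rightarrow> 'a" where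
  "bb_y f x k = nabla f (x (Suc k)) - nabla f (x k)"

definition bb_step1 :: "('a::euclidean_space \<Rightarrow> real) \<Rightarrow> (nat \<Rightarrow> 'a) \<Rightarrow> nat \<Rightarrow> real" where
  "bb_step1 f x k = (bb_s x (k - 1) \<bullet> bb_s x (k - 1)) / (bb_s x (k - 1) \<bullet> bb_y f x (k - 1))"

definition bb_step2 :: "('a::euclidean_space \<Rightarrow> real) \<Rightarrow> (nat \<Rightarrow> 'a) \<Rightarrow> nat \<Rightarrow> real" where
  "bb_step2 f x k = (bb_s x (k - 1) \<bullet> bb_y f x (k - 1)) / (bb_y f x (k - 1) \<bullet> bb_y f x (k - 1))"

(* x and \<alpha> form a run: x 0 and \<alpha> 0 are free inputs. After a vanishing gradient the
   iterates stay constant and \<alpha> is no longer constrained. Either step-size formula is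
   allowed at every step, which includes using one of them throughout. *)
definition barzilai_borwein ::
  "('a::euclidean_space \<Rightarrow> real) \<Rightarrow> (nat \<Rightarrow> 'a) \<Rightarrow> (nat \<Rightarrow> real) \<Rightarrow> bool" where
  "barzilai_borwein f x \<alpha> \<longleftrightarrow>
     (\<forall>k. x (Suc k) = (if nabla f (x k) = 0 then x k else x k - \<alpha> k *\<^sub>R nabla f (x k))) \<and>
     (\<forall>k\<ge>1. nabla f (x k) \<noteq> 0 \<longrightarrow> \<alpha> k = bb_step1 f x k \<or> \<alpha> k = bb_step2 f x k)"

definition converges_superlinearly :: "(nat \<Rightarrow> 'a::real_normed_vector) \<Rightarrow> 'a \<Rightarrow> bool" where
  "converges_superlinearly x z \<longleftrightarrow>
     (\<exists>r::nat \<Rightarrow> real. (\<forall>k. r k \<ge> 0) \<and> r \<longlonglongrightarrow> 0 \<and>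
        (\<forall>\<^sub>F k in sequentially. norm (x (Suc k) - z) \<le> r k * norm (x k - z)))"

end

theory Submission
  imports Defs
begin

text \<open>
  Strong convexity gives \<open>(\<nabla>f u - \<nabla>f v) \<bullet> (u - v) \<ge> \<mu> \<parallel>u - v\<parallel>\<^sup>2\<close>; with an equal Lipschitz
  constant this is the equality case of the Cauchy-Schwarz inequality, so
  \<open>\<nabla>f u - \<nabla>f v = \<mu> (u - v)\<close>. Both Barzilai-Borwein step sizes are then \<open>1 / \<mu>\<close>, and one
  step of that size is a Newton step for a quadratic: the gradient vanishes from \<open>x 2\<close> on, so
  the iterates have reached the minimizer and the ratios \<open>r k\<close> can be taken to be \<open>0\<close>.
\<close>

text \<open>Adding the strong convexity inequalities for \<open>(u, v)\<close> and
  \<open>(v, u)\<close> cancels the function values; the two halves \<open>\<mu> / 2\<close> add up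
  to \<open>\<mu>\<close>.\<close>

lemma strongly_convex_on_gradient_mono:
  assumes "strongly_convex_on X \<mu> f" "u \<in> X" "v \<in> X"
  shows "(nabla f u - nabla f v) \<bullet> (u - v) \<ge> \<mu> * (norm (u - v))\<^sup>2"
proof -
  have "f u \<ge> f v + nabla f v \<bullet> (u - v) + \<mu> / 2 * (norm (u - v))\<^sup>2"
    and "f v \<ge> f u + nabla f u \<bullet> (v - u) + \<mu> / 2 * (norm (v - u))\<^sup>2"
    using assms unfolding strongly_convex_on_def by blast+
  moreover have "nabla f u \<bullet> (v - u) = - (nabla f u \<bullet> (u - v))"
    by (simp add: inner_diff_right)
  ultimately show ?thesis
    by (simp add: norm_minus_commute inner_diff_left)
qed

lemma gradient_diff_eq_scaleR:
  assumes sc: "strongly_convex_on X \<mu> f" and lip: "\<mu>-lipschitz_on X (nabla f)"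
    and uv: "u \<in> X" "v \<in> X"
  shows "nabla f u - nabla f v = \<mu> *\<^sub>R (u - v)"
proof -
  define d where "d = u - v"
  define g where "g = nabla f u - nabla f v"
  have \<mu>: "\<mu> > 0"
    using sc by (simp add: strongly_convex_on_def)
  have mono: "g \<bullet> d \<ge> \<mu> * (d \<bullet> d)"
    using strongly_convex_on_gradient_mono[OF sc uv]
    by (simp add: g_def d_def power2_norm_eq_inner)
  have "norm g \<le> \<mu> * norm d"
    using lipschitz_onD[OF lip uv] by (simp add: g_def d_def dist_norm)
  then have "(norm g)\<^sup>2 \<le> (\<mu> * norm d)\<^sup>2"
    by (simp add: power_mono)
  then have g: "g \<bullet> g \<le> \<mu>\<^sup>2 * (d \<bullet> d)"
    by (simp add: power_mult_distrib power2_norm_eq_inner)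
  \<comment> \<open>Expanding the square avoids dividing by \<open>norm d\<close>, so
    \<open>u = v\<close> is no special case. The outer terms sum to at most
    \<open>2 * \<mu>\<^sup>2 * (d \<bullet> d)\<close>, and by \<open>mono\<close> the cross term
    removes at least that much.\<close>
  have "(norm (g - \<mu> *\<^sub>R d))\<^sup>2 = g \<bullet> g - 2 * \<mu> * (g \<bullet> d) + \<mu>\<^sup>2 * (d \<bullet> d)"
    unfolding power2_norm_eq_inner
    by (simp add: inner_diff_left inner_diff_right inner_commute power2_eq_square algebra_simps)
  also have "\<dots> \<le> 0"
  proof -
    have "\<mu> * (\<mu> * (d \<bullet> d)) \<le> \<mu> * (g \<bullet> d)"
      using mono \<mu> by (simp add: mult_left_mono)
    then show ?thesis
      using g by (simp add: power2_eq_square mult.assoc)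
  qed
  finally show ?thesis
    by (simp add: g_def d_def)
qed

text \<open>Strong convexity based at the critical point \<open>v\<close> makes \<open>f z\<close>
  exceed \<open>f v\<close> by a multiple of the squared distance. Only values are compared at
  \<open>z\<close>, so a minimizer on the boundary of \<open>X\<close> is covered.\<close>

lemma critical_point_eq_minimizer:
  assumes sc: "strongly_convex_on X \<mu> f" and min: "is_arg_min f (\<lambda>z. z \<in> X) z"
    and v: "v \<in> X" "nabla f v = 0"
  shows "v = z"
proof -
  have \<mu>: "\<mu> > 0" and z: "z \<in> X"
    using sc min by (simp_all add: strongly_convex_on_def is_arg_min_def)
  have "f z \<ge> f v + nabla f v \<bullet> (z - v) + \<mu> / 2 * (norm (z - v))\<^sup>2"
    using sc z v(1) unfolding strongly_convex_on_def by blast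
  moreover have "f z \<le> f v"
    using min v(1) by (auto simp: is_arg_min_def not_less)
  ultimately have "\<mu> * (norm (z - v))\<^sup>2 \<le> 0"
    using v(2) by simp
  then show ?thesis
    using \<mu> by (simp add: mult_le_0_iff)
qed

theorem corollary2:
  fixes n :: nat
    and fi :: "nat \<Rightarrow> real ^ 'p \<Rightarrow> real"
    and f :: "real ^ 'p \<Rightarrow> real"
    and X :: "(real ^ 'p) set"
    and \<mu> L :: real
    and x :: "nat \<Rightarrow> real ^ 'p"
    and \<alpha> :: "nat \<Rightarrow> real"
    and xstar :: "real ^ 'p"
  assumes f_sum: "f = (\<lambda>z. \<Sum>i=1..n. fi i z)"
    and X_bounded: "bounded X"
    and twice_diff: "\<And>z. z \<in> X \<Longrightarrow> twice_differentiable_at f z"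
    and strongly_convex: "strongly_convex_on X \<mu> f"
    and lipschitz: "L-lipschitz_on X (nabla f)"
    and minimizer: "is_arg_min f (\<lambda>z. z \<in> X) xstar"
    and run: "barzilai_borwein f x \<alpha>"
    and iterates: "\<And>k. x k \<in> X"
    and curvature: "\<And>k. k \<ge> 1 \<Longrightarrow> nabla f (x k) \<noteq> 0 \<Longrightarrow> bb_s x (k - 1) \<bullet> bb_y f x (k - 1) > 0"
    and equal: "\<mu> = L"
  shows "converges_superlinearly x xstar"
proof -
  have lip: "\<mu>-lipschitz_on X (nabla f)"
    using lipschitz equal by simp
  have \<mu>: "\<mu> > 0"
    using strongly_convex by (simp add: strongly_convex_on_def)
  note grad = gradient_diff_eq_scaleR[OF strongly_convex lip]
  have step: "x (Suc k) = (if nabla f (x k) = 0 then x k else x k - \<alpha> k *\<^sub>R nabla f (x k))" for k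
    using run unfolding barzilai_borwein_def by blast
  \<comment> \<open>\<open>\<alpha> 0\<close> is arbitrary, so the first step of controlled size
    leads from \<open>x 1\<close> to \<open>x 2\<close>.\<close>
  have crit: "nabla f (x (Suc k)) = 0" if "k \<ge> 1" for k
  proof (cases "nabla f (x k) = 0")
    case True
    then show ?thesis
      using step[of k] by simp
  next
    case False
    define s where "s = bb_s x (k - 1)"
    have y: "bb_y f x (k - 1) = \<mu> *\<^sub>R s"
      using grad[OF iterates iterates] by (simp add: bb_y_def bb_s_def s_def)
    \<comment> \<open>This excludes the quotient 0/0, which is 0 in HOL: with \<open>y\<close>, the
      two step sizes are \<open>s \<bullet> s\<close> over \<open>\<mu> * (s \<bullet> s)\<close>
      and \<open>\<mu> * (s \<bullet> s)\<close> over
      \<open>\<mu>\<^sup>2 * (s \<bullet> s)\<close>.\<close>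
    have "s \<bullet> s \<noteq> 0"
      using curvature[OF that False] y by (auto simp: s_def)
    moreover have "\<alpha> k = bb_step1 f x k \<or> \<alpha> k = bb_step2 f x k"
      using run that False unfolding barzilai_borwein_def by blast
    ultimately have \<alpha>: "\<alpha> k = 1 / \<mu>"
      using \<mu> y unfolding bb_step1_def bb_step2_def s_def[symmetric] by auto
    \<comment> \<open>The affine gradient law is now applied to the new step, whose length factor
      \<open>1 / \<mu>\<close> cancels \<open>\<mu>\<close>.\<close>
    have "nabla f (x (Suc k)) - nabla f (x k) = \<mu> *\<^sub>R (x (Suc k) - x k)"
      by (rule grad[OF iterates iterates])
    also have "\<dots> = - nabla f (x k)"
      using step[of k] False \<alpha> \<mu> by simp
    finally show ?thesis
      by simp
  qed
  have "norm (x (Suc k) - xstar) \<le> 0 * norm (x k - xstar)" if "k \<ge> 1" for k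
    using critical_point_eq_minimizer[OF strongly_convex minimizer iterates crit[OF that]]
    by simp
  then have "\<forall>\<^sub>F k in sequentially. norm (x (Suc k) - xstar) \<le> 0 * norm (x k - xstar)"
    unfolding eventually_sequentially by blast
  then show ?thesis
    unfolding converges_superlinearly_def by (intro exI[of _ "\<lambda>_. 0"]) simp
qed

end
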